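(* Let $0<\kappa^-<\kappa^+$ and $0<\mu^-<\mu^+$. Then the Hashin--Shtrikman upper bound constraint is nonconvex in $(v,\mathbf E)$; that is, the set $$\{(v,\mathbf E)\in[0,1]\times\mathbb S^{2\times2\times2\times2}:\ \langle\mathbf E\varepsilon,\varepsilon\rangle\le\langle[(1-v)\mathbf E^-+v\mathbf E^+]\varepsilon,\varepsilon\rangle-q(|\mathrm{Tr}(\varepsilon)|;v)\ \text{ for all }\varepsilon\in\mathbb S^{2\times2}\text{ with }\|\varepsilon\|_F=\sqrt2/2\}$$ is not convex.
   Context: $\mathbb S^{2\times2}$ is the space of real symmetric $2\times2$ matrices with the Frobenius inner product; $\mathbb S^{2\times2\times2\times2}$ is the space of fourth-order tensors acting as self-adjoint linear maps on $\mathbb S^{2\times2}$. $\mathbf E^\pm\varepsilon=\kappa^\pm\mathrm{Tr}(\varepsilon)I+2\mu^\pm(\varepsilon-\tfrac12\mathrm{Tr}(\varepsilon)I)$ are isotropic tensors; $\Delta\kappa=\kappa^+-\kappa^-$, $\Delta\mu=\mu^+-\mu^-$. For $t,v\in[0,1]$ the correction term $q(t;v)$ is $q(t;v)=\dfrac{v(1-v)(\Delta\kappa\,t-\Delta\mu\sqrt{1-t^2})^2}{\kappa^++\mu^+-(\Delta\kappa+\Delta\mu)v}$ if $v t\Delta\kappa\le(\kappa^++\mu^+-\Delta\kappa v)\sqrt{1-t^2}$ and $v\Delta\mu\sqrt{1-t^2}\le(\kappa^++\mu^+-\Delta\mu v)t$; $q(t;v)=(1-v)\Big[\dfrac{v t^2\Delta\kappa^2}{\kappa^++\mu^+-\Delta\kappa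 v}-(1-t^2)\Delta\mu\Big]$ if $v t\Delta\kappa>(\kappa^++\mu^+-\Delta\kappa v)\sqrt{1-t^2}$; $q(t;v)=(1-v)\Big[\dfrac{v\Delta\mu^2(1-t^2)}{\kappa^++\mu^+-\Delta\mu v}-t^2\Delta\kappa\Big]$ if $v\Delta\mu\sqrt{1-t^2}>(\kappa^++\mu^+-\Delta\mu v)t$. *)

theory Defs imports "HOL-Analysis.Analysis" begin

definition sym_matrices :: "(real^2^2) set" where
  "sym_matrices = {A. transpose A = A}"

text \<open>Symmetric matrices inherit inner product and norm from \<^typ>\<open>real^2^2\<close>; there the library's
  \<^const>\<open>inner\<close> and \<^const>\<open>norm\<close> are the Frobenius ones.\<close>

lemma inner_matrix_eq_trace: "inner A B = trace (transpose A ** B)" for A B :: "real^2^2"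
  by (simp add: inner_vec_def trace_def matrix_matrix_mult_def transpose_def sum_2)

definition tensor_app :: "real^2^2^2^2 \<Rightarrow> real^2^2 \<Rightarrow> real^2^2" where
  "tensor_app E \<epsilon> = (\<chi> i j. \<Sum>k\<in>UNIV. \<Sum>l\<in>UNIV. E $ i $ j $ k $ l * \<epsilon> $ k $ l)"

text \<open>The minor symmetries say that a tensor is determined by its action on symmetric matrices and
  takes symmetric values; the major symmetry is self-adjointness. Lemma \<open>sym_tensors_ex1\<close> below
  identifies these tensors with the self-adjoint linear maps on symmetric matrices.\<close>

definition sym_tensors :: "(real^2^2^2^2) set" where
  "sym_tensors = {E. \<forall>i j k l. E $ i $ j $ k $ l = E $ j $ i $ k $ l
                             \<and> E $ i $ j $ k $ l = E $ i $ j $ l $ k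
                             \<and> E $ i $ j $ k $ l = E $ k $ l $ i $ j}"

lemma tensor_app_sym:
  assumes "E \<in> sym_tensors"
  shows "tensor_app E \<epsilon> \<in> sym_matrices"
proof -
  have "E $ i $ j $ k $ l = E $ j $ i $ k $ l" for i j k l
    using assms unfolding sym_tensors_def by blast
  from this[of 1 2] show ?thesis
    by (simp add: sym_matrices_def tensor_app_def transpose_def vec_eq_iff forall_2)
qed

lemma tensor_app_self_adjoint:
  assumes "E \<in> sym_tensors"
  shows "inner (tensor_app E \<epsilon>) \<eta> = inner \<epsilon> (tensor_app E \<eta>)"
proof -
  have s: "E $ i $ j $ k $ l = E $ k $ l $ i $ j" for i j k l
    using assms unfolding sym_tensors_def by blast
  show ?thesis
    using s[of 1 1 1 2] s[of 1 1 2 1] s[of 1 1 2 2] s[of 1 2 2 1] s[of 1 2 2 2] s[of 2 1 2 2]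
    by (simp add: tensor_app_def inner_vec_def sum_2 algebra_simps)
qed

definition sym_unit :: "2 \<Rightarrow> 2 \<Rightarrow> real^2^2" where
  "sym_unit k l = (\<chi> i j. (if i = k \<and> j = l then 1/2 else 0) + (if i = l \<and> j = k then 1/2 else 0))"

lemma sym_unit_comm: "sym_unit k l = sym_unit l k"
  unfolding sym_unit_def by (intro arg_cong[where f = vec_lambda] ext) (rule add.commute)

lemma sym_unit_sym: "sym_unit k l \<in> sym_matrices"
  by (simp add: sym_unit_def sym_matrices_def transpose_def vec_eq_iff forall_2)

lemma inner_sym_unit:
  assumes "A \<in> sym_matrices" shows "inner A (sym_unit i j) = A $ i $ j"
proof -
  have "A $ 1 $ 2 = A $ 2 $ 1"
    using assms by (simp add: sym_matrices_def transpose_def vec_eq_iff)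
  then have "\<forall>i j. inner A (sym_unit i j) = A $ i $ j"
    by (simp add: forall_2 sym_unit_def inner_vec_def sum_2)
  then show ?thesis by blast
qed

lemma sym_tensors_ex1:
  fixes f :: "real^2^2 \<Rightarrow> real^2^2"
  assumes add: "\<And>\<epsilon> \<eta>. \<epsilon> \<in> sym_matrices \<Longrightarrow> \<eta> \<in> sym_matrices \<Longrightarrow> f (\<epsilon> + \<eta>) = f \<epsilon> + f \<eta>"
    and scale: "\<And>c \<epsilon>. \<epsilon> \<in> sym_matrices \<Longrightarrow> f (c *\<^sub>R \<epsilon>) = c *\<^sub>R f \<epsilon>"
    and range: "\<And>\<epsilon>. \<epsilon> \<in> sym_matrices \<Longrightarrow> f \<epsilon> \<in> sym_matrices"
    and adj: "\<And>\<epsilon> \<eta>. \<epsilon> \<in> sym_matrices \<Longrightarrow> \<eta> \<in> sym_matrices \<Longrightarrow> inner (f \<epsilon>) \<eta> = inner \<epsilon> (f \<eta>)"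
  shows "\<exists>!E. E \<in> sym_tensors \<and> (\<forall>\<epsilon>\<in>sym_matrices. tensor_app E \<epsilon> = f \<epsilon>)"
proof
  define E :: "real^2^2^2^2" where "E = (\<chi> i j k l. inner (f (sym_unit k l)) (sym_unit i j))"
  have E: "E $ i $ j $ k $ l = inner (f (sym_unit k l)) (sym_unit i j)" for i j k l
    by (simp add: E_def)
  have E': "E $ i $ j $ k $ l = f (sym_unit k l) $ i $ j" for i j k l
    by (simp add: E inner_sym_unit range sym_unit_sym)
  have "E \<in> sym_tensors"
    unfolding sym_tensors_def mem_Collect_eq
  proof (intro allI conjI)
    fix i j k l
    show "E $ i $ j $ k $ l = E $ j $ i $ k $ l"
      unfolding E by (subst sym_unit_comm[of i j]) (rule refl)
    show "E $ i $ j $ k $ l = E $ i $ j $ l $ k"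
      unfolding E by (subst sym_unit_comm[of k l]) (rule refl)
    show "E $ i $ j $ k $ l = E $ k $ l $ i $ j"
      unfolding E by (subst adj[OF sym_unit_sym sym_unit_sym]) (rule inner_commute)
  qed
  moreover have "tensor_app E \<epsilon> = f \<epsilon>" if e: "\<epsilon> \<in> sym_matrices" for \<epsilon>
  proof -
    have e12: "\<epsilon> $ 2 $ 1 = \<epsilon> $ 1 $ 2"
      using e by (simp add: sym_matrices_def transpose_def vec_eq_iff)
    have sc: "c *\<^sub>R sym_unit i j \<in> sym_matrices" for c i j
      using sym_unit_sym[of i j] by (simp add: sym_matrices_def transpose_def vec_eq_iff)
    have ad: "A + B \<in> sym_matrices" if "A \<in> sym_matrices" "B \<in> sym_matrices" for A B
      using that by (simp add: sym_matrices_def transpose_def vec_eq_iff)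
    have "\<epsilon> = (\<epsilon> $ 1 $ 1) *\<^sub>R sym_unit 1 1 + ((2 * \<epsilon> $ 1 $ 2) *\<^sub>R sym_unit 1 2
                 + (\<epsilon> $ 2 $ 2) *\<^sub>R sym_unit 2 2)"
      by (simp add: vec_eq_iff forall_2 sym_unit_def e12)
    then have "f \<epsilon> = f ((\<epsilon> $ 1 $ 1) *\<^sub>R sym_unit 1 1 + ((2 * \<epsilon> $ 1 $ 2) *\<^sub>R sym_unit 1 2
                 + (\<epsilon> $ 2 $ 2) *\<^sub>R sym_unit 2 2))"
      by (rule arg_cong)
    then have "f \<epsilon> = (\<epsilon> $ 1 $ 1) *\<^sub>R f (sym_unit 1 1) + ((2 * \<epsilon> $ 1 $ 2) *\<^sub>R f (sym_unit 1 2)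
                 + (\<epsilon> $ 2 $ 2) *\<^sub>R f (sym_unit 2 2))"
      by (simp only: add scale sc ad sym_unit_sym)
    then show ?thesis
      by (simp add: tensor_app_def vec_eq_iff sum_2 E' e12 sym_unit_comm[of 2 1] algebra_simps)
  qed
  ultimately show "E \<in> sym_tensors \<and> (\<forall>\<epsilon>\<in>sym_matrices. tensor_app E \<epsilon> = f \<epsilon>)"
    by blast
  fix F assume F: "F \<in> sym_tensors \<and> (\<forall>\<epsilon>\<in>sym_matrices. tensor_app F \<epsilon> = f \<epsilon>)"
  have "F $ i $ j $ k $ l = E $ i $ j $ k $ l" for i j k l
  proof -
    have "F $ i $ j $ 1 $ 2 = F $ i $ j $ 2 $ 1"
      using F unfolding sym_tensors_def by blast
    then have "\<forall>k l. tensor_app F (sym_unit k l) $ i $ j = F $ i $ j $ k $ l"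
      by (simp add: forall_2 tensor_app_def sum_2 sym_unit_def)
    then have "tensor_app F (sym_unit k l) $ i $ j = F $ i $ j $ k $ l"
      by blast
    then show ?thesis using F by (simp add: E' sym_unit_sym)
  qed
  then show "F = E" by (simp add: vec_eq_iff)
qed

definition iso_tensor :: "real \<Rightarrow> real \<Rightarrow> real^2^2^2^2" where
  "iso_tensor \<kappa> \<mu> = (\<chi> i j k l.
     \<kappa> * (mat 1 :: real^2^2) $ i $ j * (mat 1 :: real^2^2) $ k $ l
     + \<mu> * ((mat 1 :: real^2^2) $ i $ k * (mat 1 :: real^2^2) $ j $ l
          + (mat 1 :: real^2^2) $ i $ l * (mat 1 :: real^2^2) $ j $ k
          - (mat 1 :: real^2^2) $ i $ j * (mat 1 :: real^2^2) $ k $ l))"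

text \<open>Together with \<open>sym_tensors_ex1\<close> the next two lemmas characterise \<^const>\<open>iso_tensor\<close>: it is the
  isotropic elasticity tensor with bulk modulus \<open>\<kappa>\<close> and shear modulus \<open>\<mu>\<close>.\<close>

lemma iso_tensor_sym: "iso_tensor \<kappa> \<mu> \<in> sym_tensors"
  by (simp add: iso_tensor_def sym_tensors_def mat_def forall_2)

lemma tensor_app_iso_tensor:
  assumes "\<epsilon> \<in> sym_matrices"
  shows "tensor_app (iso_tensor \<kappa> \<mu>) \<epsilon>
       = (\<kappa> * trace \<epsilon>) *\<^sub>R mat 1 + (2 * \<mu>) *\<^sub>R (\<epsilon> - (trace \<epsilon> / 2) *\<^sub>R mat 1)"
proof -
  have "\<epsilon> $ 2 $ 1 = \<epsilon> $ 1 $ 2"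
    using assms by (simp add: sym_matrices_def transpose_def vec_eq_iff)
  then show ?thesis
    by (simp add: tensor_app_def iso_tensor_def vec_eq_iff forall_2 sum_2 mat_def trace_def
        algebra_simps)
qed

definition hs_correction :: "real \<Rightarrow> real \<Rightarrow> real \<Rightarrow> real \<Rightarrow> real \<Rightarrow> real \<Rightarrow> real" where
  "hs_correction \<kappa>m \<kappa>p \<mu>m \<mu>p t v =
    (let \<Delta>\<kappa> = \<kappa>p - \<kappa>m; \<Delta>\<mu> = \<mu>p - \<mu>m; s = sqrt (1 - t\<^sup>2) in
     if v * t * \<Delta>\<kappa> \<le> (\<kappa>p + \<mu>p - \<Delta>\<kappa> * v) * s \<and> v * \<Delta>\<mu> * s \<le> (\<kappa>p + \<mu>p - \<Delta>\<mu> * v) * t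
     then v * (1 - v) * (\<Delta>\<kappa> * t - \<Delta>\<mu> * s)\<^sup>2 / (\<kappa>p + \<mu>p - (\<Delta>\<kappa> + \<Delta>\<mu>) * v)
     else if v * t * \<Delta>\<kappa> > (\<kappa>p + \<mu>p - \<Delta>\<kappa> * v) * s
     then (1 - v) * (v * t\<^sup>2 * \<Delta>\<kappa>\<^sup>2 / (\<kappa>p + \<mu>p - \<Delta>\<kappa> * v) - (1 - t\<^sup>2) * \<Delta>\<mu>)
     else (1 - v) * (v * \<Delta>\<mu>\<^sup>2 * (1 - t\<^sup>2) / (\<kappa>p + \<mu>p - \<Delta>\<mu> * v) - t\<^sup>2 * \<Delta>\<kappa>))"

text \<open>In the last branch the condition is \<open>v * \<Delta>\<mu> * s > (\<kappa>p + \<mu>p - \<Delta>\<mu> * v) * t\<close>. The order of the last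
  two branches is immaterial, because their conditions exclude each other:\<close>

lemma hs_correction_cases_disjoint:
  fixes \<kappa>m \<kappa>p \<mu>m \<mu>p t v :: real
  assumes "0 < \<kappa>m" "\<kappa>m < \<kappa>p" "0 < \<mu>m" "\<mu>m < \<mu>p" "t \<in> {0..1}" "v \<in> {0..1}"
    and 2: "v * t * (\<kappa>p - \<kappa>m) > (\<kappa>p + \<mu>p - (\<kappa>p - \<kappa>m) * v) * sqrt (1 - t\<^sup>2)"
  shows "\<not> v * (\<mu>p - \<mu>m) * sqrt (1 - t\<^sup>2) > (\<kappa>p + \<mu>p - (\<mu>p - \<mu>m) * v) * t"
proof
  define s where "s = sqrt (1 - t\<^sup>2)"
  define d where "d = \<kappa>p - \<kappa>m + (\<mu>p - \<mu>m)"
  assume "v * (\<mu>p - \<mu>m) * sqrt (1 - t\<^sup>2) > (\<kappa>p + \<mu>p - (\<mu>p - \<mu>m) * v) * t"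
  with 2 have *: "(v * d) * (t + s) > (\<kappa>p + \<mu>p) * (t + s)"
    unfolding s_def[symmetric] d_def by (simp add: algebra_simps)
  have "s \<ge> 0" using assms by (simp add: s_def power_le_one)
  then have "t + s \<ge> 0" using assms by simp
  have "v * d \<le> 1 * d" using assms by (intro mult_right_mono) (auto simp: d_def)
  moreover have "1 * d \<le> \<kappa>p + \<mu>p" using assms(1,3) by (simp add: d_def)
  ultimately have "v * d \<le> \<kappa>p + \<mu>p" by (rule order.trans)
  with \<open>t + s \<ge> 0\<close> have "(v * d) * (t + s) \<le> (\<kappa>p + \<mu>p) * (t + s)"
    by (intro mult_right_mono)
  with * show False by simp
qed

end

theory Submission imports Defs begin

text \<open>The correction vanishes at \<open>v = 0\<close> and \<open>v = 1\<close>, so both pure phases satisfy the constraint. On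
  the segment between them the constraint would force the correction to be nonpositive, but at
  \<open>v = 1/2\<close> it is strictly positive on the multiple \<open>I/2\<close> of the identity, where \<open>t = 1\<close>.\<close>

text \<open>Cauchy-Schwarz against the identity matrix, whose Frobenius norm is
  \<open>sqrt 2\<close>. For strains of norm \<open>sqrt 2 / 2\<close> this gives \<bar>trace\<bar>
  \<le> 1, so the correction is only evaluated at t in [0,1].\<close>

lemma abs_trace_le_norm: "\<bar>trace A\<bar> \<le> norm A * sqrt 2" for A :: "real^2^2"
proof -
  have "trace A = inner A (mat 1)"
    by (simp add: inner_vec_def trace_def mat_def sum_2)
  moreover have "norm (mat 1 :: real^2^2) = sqrt 2"
    by (simp add: norm_eq_sqrt_inner inner_vec_def mat_def sum_2)
  ultimately show ?thesis
    using Cauchy_Schwarz_ineq2[of A "mat 1"] by simp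
qed

text \<open>At v = 0 the bounds on \<open>t\<close> force the first branch, which carries the factor
  v. The other branches carry only 1 - v, which is why they vanish at v = 1 but need not at v =
  0.\<close>

lemma hs_correction_0:
  assumes "0 \<le> \<kappa>p + \<mu>p" "0 \<le> t" "t \<le> 1"
  shows "hs_correction \<kappa>m \<kappa>p \<mu>m \<mu>p t 0 = 0"
  using assms by (simp add: hs_correction_def Let_def power_le_one)

lemma hs_correction_1: "hs_correction \<kappa>m \<kappa>p \<mu>m \<mu>p t 1 = 0"
  by (simp add: hs_correction_def Let_def)

text \<open>At t = 1 the square root is 0, so the first condition fails and the second branch
  applies. Its \<Delta>\<mu> term drops out, leaving a positive quotient.\<close>

lemma hs_correction_trace_1_pos:
  assumes "0 < \<kappa>m" "\<kappa>m < \<kappa>p" "0 \<le> \<mu>p" "0 < v" "v < 1"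
  shows "0 < hs_correction \<kappa>m \<kappa>p \<mu>m \<mu>p 1 v"
proof -
  have "(\<kappa>p - \<kappa>m) * v < \<kappa>p - \<kappa>m"
    using assms by simp
  then have "0 < \<kappa>p + \<mu>p - (\<kappa>p - \<kappa>m) * v"
    using assms by linarith
  moreover have "\<not> v * (\<kappa>p - \<kappa>m) \<le> 0"
    using assms by (simp add: not_le)
  ultimately show ?thesis
    using assms by (simp add: hs_correction_def Let_def)
qed

theorem lemma3p1:
  fixes \<kappa>m \<kappa>p \<mu>m \<mu>p :: real
  assumes "0 < \<kappa>m" and "\<kappa>m < \<kappa>p" and "0 < \<mu>m" and "\<mu>m < \<mu>p"
  shows "\<not> convex {(v, E). v \<in> {0..1} \<and> E \<in> sym_tensors \<and>
           (\<forall>\<epsilon>\<in>sym_matrices. norm \<epsilon> = sqrt 2 / 2 \<longrightarrow>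
              inner (tensor_app E \<epsilon>) \<epsilon>
              \<le> inner (tensor_app ((1 - v) *\<^sub>R iso_tensor \<kappa>m \<mu>m + v *\<^sub>R iso_tensor \<kappa>p \<mu>p) \<epsilon>) \<epsilon>
                - hs_correction \<kappa>m \<kappa>p \<mu>m \<mu>p \<bar>trace \<epsilon>\<bar> v)}"
    (is "\<not> convex ?S")
proof
  assume "convex ?S"
  have "hs_correction \<kappa>m \<kappa>p \<mu>m \<mu>p \<bar>trace \<epsilon>\<bar> 0 = 0" if "norm \<epsilon> = sqrt 2 / 2" for \<epsilon> :: "real^2^2"
  proof (intro hs_correction_0)
    have "norm \<epsilon> * sqrt 2 = 1"
      unfolding that by simp
    then show "\<bar>trace \<epsilon>\<bar> \<le> 1"
      using abs_trace_le_norm[of \<epsilon>] by simp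
  qed (use assms in auto)
  then have "(0, iso_tensor \<kappa>m \<mu>m) \<in> ?S"
    by (simp add: iso_tensor_sym)
  moreover have "(1, iso_tensor \<kappa>p \<mu>p) \<in> ?S"
    by (simp add: iso_tensor_sym hs_correction_1)
  ultimately have "(1/2) *\<^sub>R (0, iso_tensor \<kappa>m \<mu>m) + (1/2) *\<^sub>R (1, iso_tensor \<kappa>p \<mu>p) \<in> ?S"
    using \<open>convex ?S\<close> by (intro convexD) auto
  \<comment> \<open>The midpoint tensor is exactly the mixture of the phases at v = 1/2, so the two
    quadratic forms cancel and only the correction remains.\<close>
  then have mid: "hs_correction \<kappa>m \<kappa>p \<mu>m \<mu>p \<bar>trace \<epsilon>\<bar> (1/2) \<le> 0"
    if "\<epsilon> \<in> sym_matrices" "norm \<epsilon> = sqrt 2 / 2" for \<epsilon>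
    using that by simp
  \<comment> \<open>A multiple of the identity attains equality in the trace bound; the factor 1/2
    gives the prescribed norm and hence t = 1.\<close>
  define \<epsilon> :: "real^2^2" where "\<epsilon> = (1/2) *\<^sub>R mat 1"
  have "\<epsilon> \<in> sym_matrices"
    by (simp add: \<epsilon>_def sym_matrices_def transpose_def mat_def vec_eq_iff)
  moreover have "norm \<epsilon> = sqrt 2 / 2"
    by (simp add: \<epsilon>_def norm_eq_sqrt_inner inner_vec_def mat_def sum_2 real_sqrt_divide field_simps)
  moreover have "trace \<epsilon> = 1"
    by (simp add: \<epsilon>_def trace_def mat_def sum_2)
  ultimately have "hs_correction \<kappa>m \<kappa>p \<mu>m \<mu>p 1 (1/2) \<le> 0"
    using mid[of \<epsilon>] by simp
  moreover have "0 < hs_correction \<kappa>m \<kappa>p \<mu>m \<mu>p 1 (1/2)"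
    using assms by (intro hs_correction_trace_1_pos) auto
  ultimately show False by simp
qed

end
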